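(* Let $\{V_n\}_{n\geq 0}$ be the sequence defined by $V_0=1$, $V_1=8$ and, for $n\geq 1$, $n(n+1)^2 V_{n+1}=8n(3n^2+5n+1)V_n-128(n-1)(n+1)^2V_{n-1}$. Then the sequence $\{\sqrt[n]{V_n}\}_{n\geq 1}$ is strictly log-concave, that is, for all $n\geq 2$, $$\left(\sqrt[n]{V_n}\right)^2>\sqrt[n-1]{V_{n-1}}\cdot\sqrt[n+1]{V_{n+1}}.$$
   Context: $\{V_n\}$ is the Fennessey-Larcombe-French sequence; all its terms are positive. *)

theory Defs
  imports Complex_Main
begin

end

theory Submission
  imports Defs
begin

text \<open>
  Put \<open>W\<^sub>n = V\<^sub>n / 16\<^sup>n\<close>, which tends to a limit below 1. The factor \<open>16\<^sup>n\<close> does not affect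
  log-concavity of the roots, and with \<open>d\<^sub>n = ln W\<^sub>n\<^sub>+\<^sub>1 - ln W\<^sub>n\<close> the claim becomes
  \<open>n(n+1) d\<^sub>n\<^sub>-\<^sub>1 - n(n-1) d\<^sub>n > 2 ln W\<^sub>n\<close>. This holds as soon as \<open>0 \<le> d\<^sub>n \<le> d\<^sub>n\<^sub>-\<^sub>1\<close> and
  \<open>W\<^sub>n < 1\<close>. Writing \<open>W\<^sub>n / W\<^sub>n\<^sub>-\<^sub>1 = 1 + e\<^sub>n\<close>, the recurrence reads
  \<open>e\<^sub>n\<^sub>+\<^sub>1 = 1 / (2n(n+1)\<^sup>2) + (n-1)/(2n) \<cdot> e\<^sub>n / (1 + e\<^sub>n)\<close>,
  and \<open>1/n\<^sup>3 \<le> e\<^sub>n \<le> 1/(n\<^sup>2-1)\<close> follows by induction. The lower bound makes \<open>e\<^sub>n\<close> decreasing;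
  the upper bound telescopes to \<open>W\<^sub>n \<le> n/(n+1)\<close>.
\<close>

text \<open>On taking logarithms, \<open>q\<close> contributes \<open>2 * ln q\<close> to each side
  and cancels.\<close>

lemma root_log_concave_step:
  fixes a b c q :: real and n :: nat
  assumes n: "n \<ge> 2" and q: "q > 0" and a: "0 < a" and ab: "a \<le> b" and b: "b < 1"
    and c: "0 < c" and lc: "a * c \<le> b\<^sup>2"
  shows "root (n - 1) (a * q ^ (n - 1)) * root (n + 1) (c * q ^ (n + 1))
    < (root n (b * q ^ n))\<^sup>2"
proof -
  define x where "x = real n"
  have x: "x \<ge> 2" using n by (simp add: x_def)
  have bp: "0 < b" using a ab by simp
  have x1: "real (n - 1) = x - 1" "real (n + 1) = x + 1" using n by (auto simp: x_def)
  have ln_scaled: "ln (root k (y * q ^ k)) = ln y / real k + ln q" if "k > 0" "y > 0" for k y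
    using that q by (simp add: ln_root ln_mult ln_realpow field_simps)
  have i1: "ln a \<le> ln b" using a ab by simp
  have i2: "ln b < 0" using b bp by simp
  have "ln (a * c) \<le> ln (b\<^sup>2)" using lc a c bp by (subst ln_le_cancel_iff) auto
  then have i3: "ln a + ln c \<le> 2 * ln b"
    using a c bp by (simp add: ln_mult ln_realpow)
  \<comment> \<open>The weights \<open>x * (x - 1)\<close> on \<open>i3\<close> and
    \<open>2 * x\<close> on \<open>i1\<close> produce the coefficients left after clearing
    denominators. The sum is at most \<open>2 * x^2 * ln b\<close>, and \<open>ln b < 0\<close>
    gives strictness.\<close>
  have "x * (x - 1) * (ln a + ln c) \<le> x * (x - 1) * (2 * ln b)"
    by (rule mult_left_mono) (use i3 x in auto)
  moreover have "2 * x * ln a \<le> 2 * x * ln b" using i1 x by simp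
  ultimately have "x * (x + 1) * ln a + x * (x - 1) * ln c < 2 * (x + 1) * (x - 1) * ln b"
    using i2 by (simp add: algebra_simps)
  then have i4: "ln a / (x - 1) + ln c / (x + 1) < 2 * (ln b / x)"
    using x by (simp add: divide_simps) (simp add: algebra_simps)
  have p: "root (n - 1) (a * q ^ (n - 1)) > 0" "root (n + 1) (c * q ^ (n + 1)) > 0"
    "root n (b * q ^ n) > 0"
    using n a bp c q by (auto intro!: real_root_gt_zero mult_pos_pos)
  have "ln (root (n - 1) (a * q ^ (n - 1)) * root (n + 1) (c * q ^ (n + 1)))
    = ln a / (x - 1) + ln c / (x + 1) + 2 * ln q"
    using ln_scaled[of "n - 1" a] ln_scaled[of "n + 1" c] n q a c p x1
    by (simp add: ln_mult del: add_Suc_right power_Suc One_nat_def)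
  moreover have "ln ((root n (b * q ^ n))\<^sup>2) = 2 * (ln b / x) + 2 * ln q"
    using ln_scaled[of n b] n bp p by (simp add: ln_realpow x_def)
  ultimately have "ln (root (n - 1) (a * q ^ (n - 1)) * root (n + 1) (c * q ^ (n + 1)))
    < ln ((root n (b * q ^ n))\<^sup>2)" using i4 by simp
  then show ?thesis using p by (subst (asm) ln_less_cancel_iff) auto
qed

context
  fixes a b x :: real
  assumes x: "x \<ge> 2" and a: "0 < a" and lower: "(x ^ 3 + 1) * a \<le> x ^ 3 * b"
begin

text \<open>In this context \<open>x\<close>, \<open>a\<close>, \<open>b\<close> play n, W(n-1),
  W(n), and later \<open>c\<close> plays W(n+1). With e = b/a - 1, \<open>lower\<close> means e
  \<ge> 1/x^3.\<close>

lemma step_increasing: "a \<le> b"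
proof -
  have "x ^ 3 * a \<le> x ^ 3 * b" using lower a by (simp add: algebra_simps)
  then show ?thesis using x by simp
qed

text \<open>In terms of e: e/(1+e) \<ge> 1/(x^3+1) \<ge> 1/(x+1)^3, the form in which e enters the
  recurrence.\<close>

lemma step_shifted_lower: "(x + 1) ^ 3 * a \<le> ((x + 1) ^ 3 - 1) * b"
proof -
  have "a \<le> x ^ 3 * (b - a)" using lower by (simp add: algebra_simps)
  also have "\<dots> \<le> ((x + 1) ^ 3 - 1) * (b - a)"
    by (rule mult_right_mono) (use x step_increasing in \<open>auto simp: power3_eq_cube algebra_simps\<close>)
  finally show ?thesis by (simp add: algebra_simps)
qed

context
  fixes c :: real
  assumes rec: "2 * x * (x + 1)\<^sup>2 * c = x * (3 * x\<^sup>2 + 5 * x + 1) * b - (x - 1) * (x + 1)\<^sup>2 * a"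
begin

text \<open>The bound reproduces itself exactly: 1/(2x(x+1)^2) + (x-1)/(2x(x+1)^3) =
  1/(x+1)^3.\<close>

lemma step_lower: "((x + 1) ^ 3 + 1) * b \<le> (x + 1) ^ 3 * c"
proof -
  have "(x - 1) * ((x + 1) ^ 3 * a) \<le> (x - 1) * (((x + 1) ^ 3 - 1) * b)"
    by (rule mult_left_mono) (use step_shifted_lower x in auto)
  moreover have "2 * x * ((x + 1) ^ 3 * c) = (x + 1) * (2 * x * (x + 1)\<^sup>2 * c)"
    by (simp add: power3_eq_cube power2_eq_square algebra_simps)
  ultimately have "2 * x * (((x + 1) ^ 3 + 1) * b) \<le> 2 * x * ((x + 1) ^ 3 * c)"
    unfolding rec by (simp add: power3_eq_cube power2_eq_square algebra_simps)
  then show ?thesis using x by simp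
qed

lemma step_log_concave: "a * c \<le> b\<^sup>2"
proof -
  \<comment> \<open>The scaled gap between \<open>b^2\<close> and \<open>a * c\<close> splits into
    the slack of \<open>step_shifted_lower\<close> times \<open>a\<close>, plus a square.\<close>
  have "0 \<le> a * (((x + 1) ^ 3 - 1) * b - (x + 1) ^ 3 * a) + 2 * x * (x + 1)\<^sup>2 * (b - a)\<^sup>2"
    using a x step_shifted_lower by (intro add_nonneg_nonneg mult_nonneg_nonneg) auto
  also have "\<dots> = 2 * x * (x + 1)\<^sup>2 * b\<^sup>2 - a * (2 * x * (x + 1)\<^sup>2 * c)"
    unfolding rec by (simp add: power3_eq_cube power2_eq_square algebra_simps)
  finally have "(2 * x * (x + 1)\<^sup>2) * (a * c) \<le> (2 * x * (x + 1)\<^sup>2) * b\<^sup>2"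
    by (simp add: algebra_simps)
  then show ?thesis using x by (subst (asm) mult_le_cancel_left_pos) auto
qed

lemma step_upper:
  assumes upper: "(x\<^sup>2 - 1) * b \<le> x\<^sup>2 * a"
  shows "((x + 1)\<^sup>2 - 1) * c \<le> (x + 1)\<^sup>2 * b"
proof -
  have b: "0 < b" using a step_increasing by simp
  \<comment> \<open>Since \<open>a\<close> enters \<open>rec\<close> negatively, bounding it below
    by \<open>b\<close> bounds \<open>c\<close> above.\<close>
  have "(x - 1) * (x + 1)\<^sup>2 * ((x\<^sup>2 - 1) * b) \<le> (x - 1) * (x + 1)\<^sup>2 * (x\<^sup>2 * a)"
    by (rule mult_left_mono) (use upper x in auto)
  moreover have "x\<^sup>2 * (2 * x * (x + 1)\<^sup>2 * c)
      = x\<^sup>2 * x * (3 * x\<^sup>2 + 5 * x + 1) * b - (x - 1) * (x + 1)\<^sup>2 * (x\<^sup>2 * a)"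
    unfolding rec by (simp add: algebra_simps)
  ultimately have "x\<^sup>2 * (2 * x * (x + 1)\<^sup>2 * c)
      \<le> (x ^ 3 * (3 * x\<^sup>2 + 5 * x + 1) - (x - 1) * (x + 1)\<^sup>2 * (x\<^sup>2 - 1)) * b"
    by (simp add: power3_eq_cube power2_eq_square algebra_simps)
  \<comment> \<open>The factor \<open>x + 2\<close> comes from (x+1)^2 - 1 = x(x+2).\<close>
  then have "(x + 2) * (x\<^sup>2 * (2 * x * (x + 1)\<^sup>2 * c))
      \<le> (x + 2) * ((x ^ 3 * (3 * x\<^sup>2 + 5 * x + 1) - (x - 1) * (x + 1)\<^sup>2 * (x\<^sup>2 - 1)) * b)"
    by (rule mult_left_mono) (use x in auto)
  also have "\<dots> = ((x + 2) * (x ^ 3 * (3 * x\<^sup>2 + 5 * x + 1) - (x - 1) * (x + 1)\<^sup>2 * (x\<^sup>2 - 1))) * b"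
    by simp
  also have "\<dots> \<le> (2 * x\<^sup>2 * (x + 1) ^ 4) * b"
  proof (rule mult_right_mono)
    \<comment> \<open>Right minus left is x^4 - x^2 + 3x + 2; in powers of \<open>t\<close> all its
      coefficients are positive.\<close>
    define t where "t = x - 2"
    have xt: "x = t + 2" and t: "t \<ge> 0" using x by (auto simp: t_def)
    show "(x + 2) * (x ^ 3 * (3 * x\<^sup>2 + 5 * x + 1) - (x - 1) * (x + 1)\<^sup>2 * (x\<^sup>2 - 1))
        \<le> 2 * x\<^sup>2 * (x + 1) ^ 4"
      unfolding xt using t
      by (simp add: eval_nat_numeral algebra_simps)
  qed (use b in auto)
  finally have "(2 * x\<^sup>2 * (x + 1)\<^sup>2) * (((x + 1)\<^sup>2 - 1) * c)
      \<le> (2 * x\<^sup>2 * (x + 1)\<^sup>2) * ((x + 1)\<^sup>2 * b)"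
    by (simp add: eval_nat_numeral algebra_simps)
  then show ?thesis using x by (subst (asm) mult_le_cancel_left_pos) auto
qed

end

end

text \<open>One factor of the telescoping product: x/(x+1) * (x+1)^2/(x(x+2)) = (x+1)/(x+2).\<close>

lemma telescoped_bound:
  fixes b c x :: real
  assumes x: "x > 0" and b: "(x + 1) * b \<le> x" and c: "((x + 1)\<^sup>2 - 1) * c \<le> (x + 1)\<^sup>2 * b"
  shows "(x + 2) * c \<le> x + 1"
proof -
  have "x * ((x + 2) * c) = ((x + 1)\<^sup>2 - 1) * c"
    by (simp add: power2_eq_square algebra_simps)
  also have "\<dots> \<le> (x + 1) * ((x + 1) * b)" using c by (simp add: power2_eq_square algebra_simps)
  also have "\<dots> \<le> (x + 1) * x" by (rule mult_left_mono) (use b x in auto)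
  finally have "x * ((x + 2) * c) \<le> x * (x + 1)" by (simp add: mult.commute)
  then show ?thesis using x by simp
qed

theorem theorem1p2:
  fixes V :: "nat \<Rightarrow> real"
  assumes V_0: "V 0 = 1"
    and V_1: "V 1 = 8"
    and V_rec: "\<And>n::nat. n \<ge> 1 \<Longrightarrow>
      real n * (real n + 1)^2 * V (n + 1) =
        8 * real n * (3 * (real n)^2 + 5 * real n + 1) * V n
        - 128 * (real n - 1) * (real n + 1)^2 * V (n - 1)"
  shows "\<forall>n::nat. n \<ge> 2 \<longrightarrow>
    (root n (V n))^2 > root (n - 1) (V (n - 1)) * root (n + 1) (V (n + 1))"
proof (intro allI impI)
  fix n :: nat
  assume n: "n \<ge> 2"
  define W where "W k = V k / 16 ^ k" for k
  have VW: "V k = W k * 16 ^ k" for k by (simp add: W_def)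
  have W_rec: "2 * real k * (real k + 1)\<^sup>2 * W (k + 1) =
      real k * (3 * (real k)\<^sup>2 + 5 * real k + 1) * W k
      - (real k - 1) * (real k + 1)\<^sup>2 * W (k - 1)" if k: "k \<ge> 1" for k
  proof -
    \<comment> \<open>This removes the truncated \<open>k - 1\<close>; after inserting the powers of
      16, \<open>128 * 16 ^ m\<close> is a common factor of all three terms.\<close>
    obtain m where m: "k = Suc m" using k by (cases k) auto
    have "128 * 16 ^ m * (2 * real k * (real k + 1)\<^sup>2 * W (k + 1)) =
        128 * 16 ^ m * (real k * (3 * (real k)\<^sup>2 + 5 * real k + 1) * W k
      - (real k - 1) * (real k + 1)\<^sup>2 * W (k - 1))"
      using V_rec[OF k] unfolding VW by (simp add: m algebra_simps)
    then show ?thesis by simp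
  qed
  have W_1: "W 1 = 1 / 2" using V_1 by (simp add: W_def)
  have W_2: "W 2 = 9 / 16" using W_rec[of 1] W_1 by (simp add: numeral_2_eq_2)
  \<comment> \<open>The two middle bounds are 1/k^3 \<le> e_k \<le> 1/(k^2-1). The start is
    \<open>k = 2\<close>, where the lower one is an equality; at \<open>k = 1\<close> it fails, as
    \<open>W 0 = 1\<close> exceeds \<open>W 1\<close>.\<close>
  have inv: "0 < W (k - 1) \<and> (real k ^ 3 + 1) * W (k - 1) \<le> real k ^ 3 * W k
      \<and> ((real k)\<^sup>2 - 1) * W k \<le> (real k)\<^sup>2 * W (k - 1) \<and> (real k + 1) * W k \<le> real k"
    if "k \<ge> 2" for k using that
  proof (induction k rule: dec_induct)
    case base
    then show ?case using W_1 W_2 by simp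
  next
    case (step k)
    have k: "real k \<ge> 2" using step by simp
    have k1: "k \<ge> 1" using step by simp
    note ih = step.IH
    note lo = step_lower[OF k _ _ W_rec[OF k1]]
    note up = step_upper[OF k _ _ W_rec[OF k1]]
    have "0 < W k" using step_increasing[OF k, of "W (k - 1)" "W k"] ih by linarith
    moreover have "(real k + 2) * W (k + 1) \<le> real k + 1"
      by (rule telescoped_bound[of _ "W k"]) (use ih up k in auto)
    ultimately show ?case using lo up ih by (simp add: add.commute)
  qed
  have x: "real n \<ge> 2" and n1: "n \<ge> 1" using n by auto
  note i = inv[OF n]
  have ab: "W (n - 1) \<le> W n"
    using step_increasing[OF x, of "W (n - 1)" "W n"] i by simp
  have lc: "W (n - 1) * W (n + 1) \<le> (W n)\<^sup>2"
    using step_log_concave[OF x _ _ W_rec[OF n1]] i by simp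
  have "W n < 1"
  proof (rule ccontr)
    assume "\<not> W n < 1"
    then have "real n + 1 \<le> (real n + 1) * W n" by simp
    moreover have "(real n + 1) * W n \<le> real n" using i by blast
    ultimately show False by linarith
  qed
  moreover have "0 < W (n + 1)"
    using inv[of "n + 2"] by simp
  ultimately show "root (n - 1) (V (n - 1)) * root (n + 1) (V (n + 1)) < (root n (V n))\<^sup>2"
    unfolding VW using i ab lc n by (intro root_log_concave_step) auto
qed

end
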